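(* Let $G=(V,E)$ be a water distribution system with reservoir nodes $V_{\mathrm r}$ and consumer nodes $V_{\mathrm c}$, and put $n_{\mathrm c}=|V_{\mathrm c}|$. Let $E_{\mathrm i}\subset E$ be any set of $n_{\mathrm c}$ edges such that the corresponding $n_{\mathrm c}$ columns of $B_{V_{\mathrm c}\cdot}$ are linearly independent, and let $E_{\mathrm d}=E\setminus E_{\mathrm i}$. Let reservoir heads $h_{V_{\mathrm r}}\in\mathbb{R}^{V_{\mathrm r}}$ and flows $q_{E_{\mathrm i}}\in\mathbb{R}^{E_{\mathrm i}}$ be given. Then there exists exactly one triple $(h_{V_{\mathrm c}},q_{E_{\mathrm d}},d)$ of consumer heads $h_{V_{\mathrm c}}\in\mathbb{R}^{V_{\mathrm c}}$, remaining flows $q_{E_{\mathrm d}}\in\mathbb{R}^{E_{\mathrm d}}$ and demands $d\in\mathbb{R}^{V_{\mathrm c}}$ such that $(h,q,d)$ is physically correct, where $h\in\mathbb{R}^V$ is the vector with restrictions $h_{V_{\mathrm r}}$ and $h_{V_{\mathrm c}}$ to $V_{\mathrm r}$ and $V_{\mathrm c}$, and $q\in\mathbb{R}^E$ is the vector with restrictions $q_{E_{\mathrm i}}$ and $q_{E_{\mathrm d}}$ to $E_{\mathrm i}$ and $E_{\mathrm d}$.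
   Context: A water distribution system (WDS) is a finite, connected, symmetric directed graph $G=(V,E)$ with $V\neq\emptyset$, $E\neq\emptyset$, whose edges are ordered pairs of distinct nodes; $e_{vu}=(v,u)$ denotes the edge from $v$ to $u$, and symmetric means $e_{vu}\in E$ implies $e_{uv}\in E$. The node set is a disjoint union $V=V_{\mathrm r}\sqcup V_{\mathrm c}$ of a nonempty set $V_{\mathrm r}$ of reservoir nodes and a nonempty set $V_{\mathrm c}$ of consumer nodes. The neighborhood of $v$ is $\mathcal N(v)=\{u\in V: e_{vu}\in E \text{ or } e_{uv}\in E\}$. Each edge carries a resistance coefficient $r_{vu}=10.67\, l_{vu}\,\rho_{vu}^{-4.8704}\,\eta_{vu}^{-1.852}>0$, where the length $l_{vu}=l_{uv}>0$, diameter $\rho_{vu}=\rho_{uv}>0$ and roughness $\eta_{vu}=\eta_{uv}>0$ are symmetric (so $r_{vu}=r_{uv}$), and $x=1.852$. A hydraulic state is a triple $(h,q,d)$ of heads $h=(h_v)_{v\in V}$, flows $q=(q_e)_{e\in E}$ (write $q_{vu}=q_{e_{vu}}$) and demands $d=(d_v)_{v\in V_{\mathrm c}}$; all entries are real numbers. It is called physically correct if and only if the following three conditions hold: (1) conservation of energy: $h_v-h_u=r_{vu}\,q_{vu}\,|q_{vu}|^{x-1}$ for all $v\in V$, $u\in\mathcal N(v)$; (2) conservation of mass: $\sum_{u\in\mathcal N(v)}q_{vu}=-d_v$ for all $v\in V_{\mathrm c}$; (3) conservation of flows: $q_{uv}=-q_{vu}$ for all $v\in V$, $u\in\mathcal N(v)$.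 The incidence matrix $B\in\mathbb{R}^{V\times E}$ has entry $1$ at $(v,e)$ if $e=e_{vu}$ for some $u$, entry $-1$ if $e=e_{uv}$ for some $u$, and $0$ otherwise. $B_{V_{\mathrm c}\cdot}\in\mathbb{R}^{V_{\mathrm c}\times E}$ is the submatrix of the rows indexed by $V_{\mathrm c}$. *)

theory Defs
  imports "HOL-Analysis.Analysis" "Graph_Theory.Graph_Theory"
begin

text \<open>
  The edge from \<open>v\<close> to \<open>u\<close> is the pair \<open>(v, u)\<close>. Quantities attached to nodes (edges) are total
  functions on the node type (on pairs of nodes); only their values on the relevant carrier
  matter. The locale \<open>pair_graph\<close> says that \<open>G\<close> is finite, symmetric and has no loops; the graph
  notion of connectedness must be written qualified, as the plain name is the topological one.
\<close>

locale water_distribution_system = pair_graph G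
  for G :: "'v pair_pre_digraph" +
  fixes Vr Vc :: "'v set"
    and l \<rho> \<eta> :: "'v \<times> 'v \<Rightarrow> real"
  assumes connected: "Digraph_Component.connected (with_proj G)"
    and nodes_nonempty: "pverts G \<noteq> {}"
    and edges_nonempty: "parcs G \<noteq> {}"
    and nodes_split: "pverts G = Vr \<union> Vc" "Vr \<inter> Vc = {}"
    and reservoirs_nonempty: "Vr \<noteq> {}"
    and consumers_nonempty: "Vc \<noteq> {}"
    and length_pos: "(v, u) \<in> parcs G \<Longrightarrow> l (v, u) > 0"
    and length_sym: "(v, u) \<in> parcs G \<Longrightarrow> l (v, u) = l (u, v)"
    and diameter_pos: "(v, u) \<in> parcs G \<Longrightarrow> \<rho> (v, u) > 0"
    and diameter_sym: "(v, u) \<in> parcs G \<Longrightarrow> \<rho> (v, u) = \<rho> (u, v)"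
    and roughness_pos: "(v, u) \<in> parcs G \<Longrightarrow> \<eta> (v, u) > 0"
    and roughness_sym: "(v, u) \<in> parcs G \<Longrightarrow> \<eta> (v, u) = \<eta> (u, v)"

definition neighborhood :: "'v pair_pre_digraph \<Rightarrow> 'v \<Rightarrow> 'v set" where
  "neighborhood G v = {u \<in> pverts G. (v, u) \<in> parcs G \<or> (u, v) \<in> parcs G}"

definition flow_exponent :: real where
  "flow_exponent = 1.852"

text \<open>The Hazen--Williams formula.\<close>

definition resistance ::
  "('v \<times> 'v \<Rightarrow> real) \<Rightarrow> ('v \<times> 'v \<Rightarrow> real) \<Rightarrow> ('v \<times> 'v \<Rightarrow> real) \<Rightarrow> 'v \<times> 'v \<Rightarrow> real" where
  "resistance l \<rho> \<eta> e = 10.67 * l e * \<rho> e powr (-4.8704) * \<eta> e powr (-1.852)"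

definition physically_correct ::
  "'v pair_pre_digraph \<Rightarrow> 'v set \<Rightarrow> ('v \<times> 'v \<Rightarrow> real) \<Rightarrow>
   ('v \<Rightarrow> real) \<Rightarrow> ('v \<times> 'v \<Rightarrow> real) \<Rightarrow> ('v \<Rightarrow> real) \<Rightarrow> bool" where
  "physically_correct G Vc r h q d \<longleftrightarrow>
     (\<forall>v\<in>pverts G. \<forall>u\<in>neighborhood G v.
        h v - h u = r (v, u) * q (v, u) * \<bar>q (v, u)\<bar> powr (flow_exponent - 1)) \<and>
     (\<forall>v\<in>Vc. (\<Sum>u\<in>neighborhood G v. q (v, u)) = - d v) \<and>
     (\<forall>v\<in>pverts G. \<forall>u\<in>neighborhood G v. q (u, v) = - q (v, u))"

definition incidence :: "'v \<Rightarrow> 'v \<times> 'v \<Rightarrow> real" where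
  "incidence v e = (if \<exists>u. e = (v, u) then 1 else if \<exists>u. e = (u, v) then -1 else 0)"

text \<open>
  Linear independence of the family of columns \<open>C\<close> of the submatrix of \<open>M\<close> formed by the
  rows \<open>R\<close>. This concerns the family and not the set of columns: two different edges into the
  same consumer, both from reservoirs, have equal columns and hence are dependent. The lemma
  below relates it to the library notion when the row index type is finite.
\<close>

definition independent_columns :: "'i set \<Rightarrow> 'j set \<Rightarrow> ('i \<Rightarrow> 'j \<Rightarrow> real) \<Rightarrow> bool" where
  "independent_columns R C M \<longleftrightarrow>
     (\<forall>c. (\<forall>i\<in>R. (\<Sum>j\<in>C. c j * M i j) = 0) \<longrightarrow> (\<forall>j\<in>C. c j = 0))"

lemma independent_columns_iff_independent:
  fixes M :: "'i::finite \<Rightarrow> 'j \<Rightarrow> real"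
    and R :: "'i set"
  assumes fin: "finite C"
  defines "col \<equiv> \<lambda>j. (\<chi> i. if i \<in> R then M i j else 0) :: real ^ 'i"
  shows "independent_columns R C M \<longleftrightarrow> inj_on col C \<and> independent (col ` C)"
proof -
  have comb: "(\<Sum>j\<in>C. c j *\<^sub>R col j) = 0 \<longleftrightarrow> (\<forall>i\<in>R. (\<Sum>j\<in>C. c j * M i j) = 0)" for c
  proof -
    have "(\<Sum>j\<in>C. c j *\<^sub>R col j) $ i = (if i \<in> R then \<Sum>j\<in>C. c j * M i j else 0)" for i
      by (simp add: col_def)
    thus ?thesis by (auto simp: vec_eq_iff simp del: sum_component)
  qed
  show ?thesis
  proof
    assume ind: "independent_columns R C M"
    have zero: "c j = 0" if "(\<Sum>j\<in>C. c j *\<^sub>R col j) = 0" "j \<in> C" for c j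
      using ind that comb[of c] unfolding independent_columns_def by blast
    have inj: "inj_on col C"
    proof (rule inj_onI, rule ccontr)
      fix a b assume ab: "a \<in> C" "b \<in> C" "col a = col b" "a \<noteq> b"
      define c :: "'j \<Rightarrow> real" where "c = (\<lambda>j. (if j = a then 1 else 0) - (if j = b then 1 else 0))"
      have "(\<Sum>j\<in>C. c j *\<^sub>R col j)
          = (\<Sum>j\<in>C. (if j = a then col j else 0) - (if j = b then col j else 0))"
        by (intro sum.cong) (auto simp: c_def)
      also have "\<dots> = 0"
        using ab fin by (simp add: sum_subtractf)
      finally have "c a = 0" using zero ab(1) by blast
      thus False using ab(4) by (simp add: c_def)
    qed
    have "independent (col ` C)"
    proof (rule real_vector.independent_if_scalars_zero)
      show "finite (col ` C)" using fin by simp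
      fix f x assume "(\<Sum>x\<in>col ` C. f x *\<^sub>R x) = 0" "x \<in> col ` C"
      moreover from this obtain j where "j \<in> C" "x = col j" by blast
      ultimately show "f x = 0"
        using zero[of "f \<circ> col" j] by (simp add: sum.reindex[OF inj])
    qed
    with inj show "inj_on col C \<and> independent (col ` C)" ..
  next
    assume ass: "inj_on col C \<and> independent (col ` C)"
    show "independent_columns R C M"
      unfolding independent_columns_def
    proof (intro allI impI ballI)
      fix c j assume c: "\<forall>i\<in>R. (\<Sum>j\<in>C. c j * M i j) = 0" and j: "j \<in> C"
      have "(\<Sum>x\<in>col ` C. c (the_inv_into C col x) *\<^sub>R x) = (\<Sum>j\<in>C. c j *\<^sub>R col j)"
        using ass by (simp add: sum.reindex the_inv_into_f_f)
      also have "\<dots> = 0" using c comb by blast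
      finally have "c (the_inv_into C col (col j)) = 0"
        using ass j fin real_vector.independentD[of "col ` C" "col ` C"
            "\<lambda>x. c (the_inv_into C col x)" "col j"] by simp
      thus "c j = 0" using ass j by (simp add: the_inv_into_f_f)
    qed
  qed
qed

end

theory Submission
  imports Defs
begin

text \<open>
  The argument rests on two facts. First, the energy law on a single edge is a bijection between
  flows and head differences, because the head loss \<open>q \<mapsto> r q \<bar>q\<bar>\<^sup>x\<^sup>-\<^sup>1\<close> is an odd, strictly increasing
  function of the flow with an explicit inverse on the whole line. Hence the heads determine a physically correct state completely: the flows
  are the inverse head losses of the head differences, antisymmetry of the flows holds because
  that inverse is odd and the resistance symmetric, and the demands are read off from the mass
  balance (\<open>physically_correct_iff_flow_of_head_difference\<close>). So what remains is to find the
  consumer heads for which the flows on the independent edges come out as prescribed.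

  Secondly, this last requirement is a linear system for the consumer heads. The head difference
  along an edge is the pairing of the heads with the corresponding column of the incidence matrix;
  the share of the reservoirs is known, so the prescribed flows say what the pairing of the
  consumer heads with each of the chosen columns is. There are as many columns as consumers and
  they are independent, so the transposed system is uniquely solvable for every right-hand side
  (\<open>independent_columns_transposed_unique_solution\<close>).
\<close>

section \<open>Square linear systems over arbitrary finite index sets\<close>

text \<open>
  Independent columns admit a dual family, which is built one column at a time. Subtracting from
  the new column its components along the old ones leaves a nonzero vector; at a row \<open>i\<close> where
  that vector does not vanish, the unit vector of \<open>i\<close> minus the combination of the old dual family
  that has the same pairings with the old columns annihilates these but not the new column. A
  multiple of it corrects a solution for the old columns at the new one.
\<close>

lemma independent_columns_transposed_solvable:
  fixes M :: "'i \<Rightarrow> 'j \<Rightarrow> real"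
  assumes "finite C" "finite R" "independent_columns R C M"
  shows "\<exists>x. \<forall>j\<in>C. (\<Sum>i\<in>R. x i * M i j) = g j"
  using assms(1,3)
proof (induction C arbitrary: g rule: finite_induct)
  case empty
  show ?case by simp
next
  case (insert j C)
  have "independent_columns R C M"
    unfolding independent_columns_def
  proof (intro allI impI)
    fix c assume c: "\<forall>i\<in>R. (\<Sum>k\<in>C. c k * M i k) = 0"
    have "(\<Sum>k\<in>insert j C. (c(j := 0)) k * M i k) = (\<Sum>k\<in>C. c k * M i k)" for i
      using insert.hyps by (auto intro!: sum.cong)
    with c have "\<forall>i\<in>R. (\<Sum>k\<in>insert j C. (c(j := 0)) k * M i k) = 0" by metis
    then have "\<forall>k\<in>insert j C. (c(j := 0)) k = 0"
      using insert.prems unfolding independent_columns_def by blast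
    with insert.hyps show "\<forall>k\<in>C. c k = 0" by (auto split: if_splits)
  qed
  note solve = insert.IH[OF this]
  have "\<exists>x. \<forall>l\<in>C. (\<Sum>i\<in>R. x i * M i l) = (if l = k then 1 else 0)" for k
    by (rule solve)
  then obtain y where y: "\<And>k l. l \<in> C \<Longrightarrow> (\<Sum>i\<in>R. y k i * M i l) = (if l = k then 1 else 0)"
    by metis
  define a where "a k = (\<Sum>i\<in>R. y k i * M i j)" for k
  define w where "w i = M i j - (\<Sum>k\<in>C. a k * M i k)" for i
  have "\<exists>i\<in>R. w i \<noteq> 0"
  proof (rule ccontr)
    assume "\<not> (\<exists>i\<in>R. w i \<noteq> 0)"
    define c where "c = (\<lambda>k. - a k)(j := 1)"
    have "(\<Sum>k\<in>insert j C. c k * M i k) = w i" for i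
    proof -
      have "(\<Sum>k\<in>C. c k * M i k) = (\<Sum>k\<in>C. - (a k * M i k))"
        using insert.hyps by (auto simp: c_def intro!: sum.cong)
      then show ?thesis using insert.hyps by (simp add: c_def w_def sum_negf)
    qed
    with \<open>\<not> (\<exists>i\<in>R. w i \<noteq> 0)\<close> have "\<forall>i\<in>R. (\<Sum>k\<in>insert j C. c k * M i k) = 0" by simp
    then have "c j = 0"
      using insert.prems unfolding independent_columns_def by blast
    then show False by (simp add: c_def)
  qed
  then obtain i where i: "i \<in> R" "w i \<noteq> 0" by blast
  define z where "z m = (if m = i then 1 else 0) - (\<Sum>k\<in>C. M i k * y k m)" for m
  have z: "(\<Sum>m\<in>R. z m * M m l) = M i l - (\<Sum>k\<in>C. M i k * (\<Sum>m\<in>R. y k m * M m l))" for l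
  proof -
    have "(\<Sum>m\<in>R. z m * M m l)
        = (\<Sum>m\<in>R. if m = i then M m l else 0) - (\<Sum>m\<in>R. \<Sum>k\<in>C. M i k * (y k m * M m l))"
      unfolding sum_subtractf[symmetric]
      by (intro sum.cong refl) (simp add: z_def left_diff_distrib sum_distrib_right mult.assoc)
    also have "(\<Sum>m\<in>R. \<Sum>k\<in>C. M i k * (y k m * M m l)) = (\<Sum>k\<in>C. \<Sum>m\<in>R. M i k * (y k m * M m l))"
      by (rule sum.swap)
    finally show ?thesis
      using i(1) assms(2) by (simp add: sum_distrib_left)
  qed
  have zC: "(\<Sum>m\<in>R. z m * M m l) = 0" if "l \<in> C" for l
    using that insert.hyps by (simp add: z y if_distrib cong: if_cong)
  have zj: "(\<Sum>m\<in>R. z m * M m j) = w i"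
    by (simp add: z w_def a_def mult.commute)
  obtain x where x: "\<forall>l\<in>C. (\<Sum>i\<in>R. x i * M i l) = g l" using solve by blast
  define t where "t = (g j - (\<Sum>m\<in>R. x m * M m j)) / w i"
  have "(\<Sum>m\<in>R. (x m + t * z m) * M m l) = (\<Sum>m\<in>R. x m * M m l) + t * (\<Sum>m\<in>R. z m * M m l)" for l
    by (simp add: distrib_right sum.distrib sum_distrib_left mult.assoc)
  then have "\<forall>l\<in>insert j C. (\<Sum>m\<in>R. (x m + t * z m) * M m l) = g l"
    using x zC zj i(2) by (auto simp: t_def)
  then show ?case by (intro exI)
qed

text \<open>
  One step of Gaussian elimination: clearing the pivot row of a column by column operations
  leaves independent columns in one row fewer.
\<close>

lemma independent_columns_card_le:
  fixes M :: "'i \<Rightarrow> 'j \<Rightarrow> real"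
  assumes "finite C" "finite R" "independent_columns R C M"
  shows "card C \<le> card R"
  using assms
proof (induction C arbitrary: R M rule: finite_induct)
  case empty
  show ?case by simp
next
  case (insert j C)
  have "\<exists>i\<in>R. M i j \<noteq> 0"
  proof (rule ccontr)
    assume zero: "\<not> (\<exists>i\<in>R. M i j \<noteq> 0)"
    define c :: "'j \<Rightarrow> real" where "c k = (if k = j then 1 else 0)" for k
    have "(\<Sum>k\<in>C. c k * M i k) = 0" for i
      using insert.hyps by (auto simp: c_def intro!: sum.neutral)
    with zero have "\<forall>i\<in>R. (\<Sum>k\<in>insert j C. c k * M i k) = 0"
      using insert.hyps by simp
    then have "c j = 0"
      using insert.prems(2) unfolding independent_columns_def by blast
    then show False by (simp add: c_def)
  qed
  then obtain i where i: "i \<in> R" "M i j \<noteq> 0" by blast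
  define N where "N m k = M m k - M m j * (M i k / M i j)" for m k
  have "independent_columns (R - {i}) C N"
    unfolding independent_columns_def
  proof (intro allI impI)
    fix c assume c: "\<forall>m\<in>R - {i}. (\<Sum>k\<in>C. c k * N m k) = 0"
    define c' where "c' = c(j := - (\<Sum>k\<in>C. c k * (M i k / M i j)))"
    have c': "(\<Sum>k\<in>insert j C. c' k * M m k) = (\<Sum>k\<in>C. c k * N m k)" for m
    proof -
      have "(\<Sum>k\<in>C. c' k * M m k) = (\<Sum>k\<in>C. c k * M m k)"
        using insert.hyps by (auto simp: c'_def intro!: sum.cong)
      moreover have "(\<Sum>k\<in>C. c k * N m k)
          = (\<Sum>k\<in>C. c k * M m k) - M m j * (\<Sum>k\<in>C. c k * (M i k / M i j))"
        unfolding N_def sum_distrib_left sum_subtractf[symmetric]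
        by (intro sum.cong) (auto simp: algebra_simps)
      ultimately show ?thesis
        using insert.hyps by (simp add: c'_def mult.commute)
    qed
    have "(\<Sum>k\<in>C. c k * N i k) = 0"
      using i(2) by (simp add: N_def)
    with c have "\<forall>m\<in>R. (\<Sum>k\<in>C. c k * N m k) = 0" by blast
    then have "\<forall>k\<in>insert j C. c' k = 0"
      using insert.prems(2) c' unfolding independent_columns_def by simp
    then show "\<forall>k\<in>C. c k = 0"
      using insert.hyps by (auto simp: c'_def split: if_splits)
  qed
  then have "card C \<le> card (R - {i})"
    using insert.IH[of "R - {i}" N] insert.prems(1) by blast
  then show ?case
    using insert.hyps insert.prems(1) i(1) card_Suc_Diff1[of R i] by simp
qed

text \<open>
  A nontrivial relation between the rows would express one row by the others, so the columns
  would stay independent without that row, although they would then outnumber the rows.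
\<close>

lemma independent_columns_square_rows_independent:
  fixes M :: "'i \<Rightarrow> 'j \<Rightarrow> real"
  assumes "finite C" "finite R" "independent_columns R C M" "card C = card R"
    and x: "\<forall>j\<in>C. (\<Sum>i\<in>R. x i * M i j) = 0" and "i \<in> R"
  shows "x i = 0"
proof (rule ccontr)
  assume nz: "x i \<noteq> 0"
  have "independent_columns (R - {i}) C M"
    unfolding independent_columns_def
  proof (intro allI impI)
    fix c assume c: "\<forall>m\<in>R - {i}. (\<Sum>j\<in>C. c j * M m j) = 0"
    have "x i * (\<Sum>j\<in>C. c j * M i j) = (\<Sum>m\<in>R. x m * (\<Sum>j\<in>C. c j * M m j))"
      using c assms(2) \<open>i \<in> R\<close> by (simp add: sum.remove)
    also have "\<dots> = (\<Sum>m\<in>R. \<Sum>j\<in>C. c j * (x m * M m j))"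
      by (simp add: sum_distrib_left algebra_simps)
    also have "\<dots> = (\<Sum>j\<in>C. \<Sum>m\<in>R. c j * (x m * M m j))"
      by (rule sum.swap)
    also have "\<dots> = (\<Sum>j\<in>C. c j * (\<Sum>m\<in>R. x m * M m j))"
      by (simp add: sum_distrib_left)
    also have "\<dots> = 0"
      using x by simp
    finally have "(\<Sum>j\<in>C. c j * M i j) = 0"
      using nz by simp
    with c have "\<forall>m\<in>R. (\<Sum>j\<in>C. c j * M m j) = 0" by blast
    then show "\<forall>j\<in>C. c j = 0"
      using assms(3) unfolding independent_columns_def by blast
  qed
  then have "card C \<le> card (R - {i})"
    using independent_columns_card_le assms(1,2) by blast
  moreover have "card (R - {i}) < card R"
    using assms(2) \<open>i \<in> R\<close> by (intro psubset_card_mono) auto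
  ultimately show False using assms(4) by simp
qed

lemma independent_columns_transposed_unique_solution:
  fixes M :: "'i \<Rightarrow> 'j \<Rightarrow> real"
  assumes "finite C" "finite R" "independent_columns R C M" "card C = card R"
  shows "\<exists>!x. x \<in> R \<rightarrow>\<^sub>E UNIV \<and> (\<forall>j\<in>C. (\<Sum>i\<in>R. x i * M i j) = g j)"
proof (rule ex_ex1I)
  obtain x where "\<forall>j\<in>C. (\<Sum>i\<in>R. x i * M i j) = g j"
    using independent_columns_transposed_solvable assms(1-3) by blast
  then have "restrict x R \<in> R \<rightarrow>\<^sub>E UNIV \<and> (\<forall>j\<in>C. (\<Sum>i\<in>R. restrict x R i * M i j) = g j)"
    by simp
  then show "\<exists>x. x \<in> R \<rightarrow>\<^sub>E UNIV \<and> (\<forall>j\<in>C. (\<Sum>i\<in>R. x i * M i j) = g j)" by (intro exI)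
next
  fix x y
  assume x: "x \<in> R \<rightarrow>\<^sub>E UNIV \<and> (\<forall>j\<in>C. (\<Sum>i\<in>R. x i * M i j) = g j)"
    and y: "y \<in> R \<rightarrow>\<^sub>E UNIV \<and> (\<forall>j\<in>C. (\<Sum>i\<in>R. y i * M i j) = g j)"
  then have "\<forall>j\<in>C. (\<Sum>i\<in>R. (x i - y i) * M i j) = 0"
    by (simp add: left_diff_distrib sum_subtractf)
  then have "x i - y i = 0" if "i \<in> R" for i
    using independent_columns_square_rows_independent[OF assms, of "\<lambda>i. x i - y i" i] that by simp
  then show "x = y"
    using x y by (intro PiE_ext[of _ R "\<lambda>_. UNIV"]) auto
qed

lemma extensional_values_iff:
  "f \<in> A \<rightarrow>\<^sub>E UNIV \<and> (\<forall>a\<in>A. f a = k a) \<longleftrightarrow> f = restrict k A"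
  by (auto simp: PiE_def extensional_def restrict_def fun_eq_iff)

section \<open>The energy law on a single edge\<close>

definition head_loss :: "real \<Rightarrow> real \<Rightarrow> real" where
  "head_loss r q = r * q * \<bar>q\<bar> powr (flow_exponent - 1)"

definition flow_of_head_loss :: "real \<Rightarrow> real \<Rightarrow> real" where
  "flow_of_head_loss r a = sgn a * (\<bar>a\<bar> / r) powr (1 / flow_exponent)"

text \<open>
  The head loss multiplies the sign of the flow by \<open>r\<close> times the \<open>x\<close>-th power of its absolute
  value, and both factors can be inverted separately.
\<close>

lemma head_loss_eq_iff:
  assumes "r > 0"
  shows "head_loss r q = a \<longleftrightarrow> q = flow_of_head_loss r a"
proof -
  have signed_power: "head_loss r q = sgn q * (r * \<bar>q\<bar> powr flow_exponent)" for q
  proof (cases "q = 0")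
    case False
    then have "\<bar>q\<bar> powr flow_exponent = \<bar>q\<bar> * \<bar>q\<bar> powr (flow_exponent - 1)"
      by (simp add: powr_diff)
    moreover have "sgn q * \<bar>q\<bar> = q" by (rule sgn_mult_abs)
    ultimately show ?thesis by (simp add: head_loss_def mult.left_commute mult.assoc[symmetric])
  qed (simp add: head_loss_def)
  have pos: "flow_exponent > 0" by (simp add: flow_exponent_def)
  show ?thesis
  proof
    assume a: "head_loss r q = a"
    have "sgn a = sgn q"
      using assms by (cases "q = 0") (auto simp: a[symmetric] signed_power sgn_mult)
    moreover have "\<bar>a\<bar> / r = \<bar>q\<bar> powr flow_exponent"
      using assms by (cases "q = 0") (auto simp: a[symmetric] signed_power abs_mult abs_sgn_eq)
    ultimately show "q = flow_of_head_loss r a"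
      using pos by (simp add: flow_of_head_loss_def powr_powr sgn_mult_abs)
  next
    assume q: "q = flow_of_head_loss r a"
    have "sgn q = sgn a"
      using assms by (cases "a = 0") (auto simp: q flow_of_head_loss_def sgn_mult)
    moreover have "\<bar>q\<bar> = (\<bar>a\<bar> / r) powr (1 / flow_exponent)"
      using assms by (cases "a = 0") (auto simp: q flow_of_head_loss_def abs_mult abs_sgn_eq)
    ultimately show "head_loss r q = a"
      using assms pos by (simp add: signed_power powr_powr sgn_mult_abs)
  qed
qed

lemma flow_of_head_loss_minus: "flow_of_head_loss r (- a) = - flow_of_head_loss r a"
  by (simp add: flow_of_head_loss_def sgn_minus)

section \<open>States determined by their heads\<close>

lemma sum_incidence:
  assumes "finite V" "v \<in> V" "u \<in> V" "v \<noteq> u"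
  shows "(\<Sum>w\<in>V. h w * incidence w (v, u)) = h v - h u"
proof -
  have "(\<Sum>w\<in>V. h w * incidence w (v, u))
      = (\<Sum>w\<in>V. (if w = v then h w else 0) - (if w = u then h w else 0))"
    using assms(4) by (intro sum.cong) (auto simp: incidence_def)
  then show ?thesis using assms by (simp add: sum_subtractf)
qed

context water_distribution_system
begin

lemma resistance_pos: "e \<in> parcs G \<Longrightarrow> resistance l \<rho> \<eta> e > 0"
  using length_pos diameter_pos roughness_pos by (cases e) (force simp: resistance_def)

lemma resistance_sym: "(v, u) \<in> parcs G \<Longrightarrow> resistance l \<rho> \<eta> (u, v) = resistance l \<rho> \<eta> (v, u)"
  by (simp add: resistance_def length_sym diameter_sym roughness_sym)

lemma arc_reversed: "(v, u) \<in> parcs G \<Longrightarrow> (u, v) \<in> parcs G"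
  using arcs_ends_symmetric[OF pair_sym_arcs] by simp

lemma neighborhood_eq: "neighborhood G v = {u. (v, u) \<in> parcs G}"
  using arc_reversed by (auto simp: neighborhood_def dest: in_arcsD2)

text \<open>
  Conservation of flows comes out of the energy law: the two directions of an edge see opposite
  head differences and the same resistance, and the inverse head loss is odd.
\<close>

lemma physically_correct_iff_flow_of_head_difference:
  "physically_correct G Vc (resistance l \<rho> \<eta>) h q d \<longleftrightarrow>
     (\<forall>e\<in>parcs G. q e = flow_of_head_loss (resistance l \<rho> \<eta> e) (h (fst e) - h (snd e))) \<and>
     (\<forall>v\<in>Vc. d v = - (\<Sum>u\<in>neighborhood G v. q (v, u)))"
  (is "?correct \<longleftrightarrow> ?flows \<and> ?demands")
proof -
  let ?r = "resistance l \<rho> \<eta>"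
  have arcs: "(\<forall>v\<in>pverts G. \<forall>u\<in>neighborhood G v. P v u) \<longleftrightarrow> (\<forall>(v, u)\<in>parcs G. P v u)" for P
    using in_arcsD1 by (auto simp: neighborhood_eq)
  have "(\<forall>v\<in>pverts G. \<forall>u\<in>neighborhood G v.
          h v - h u = ?r (v, u) * q (v, u) * \<bar>q (v, u)\<bar> powr (flow_exponent - 1)) \<longleftrightarrow> ?flows"
    unfolding arcs head_loss_def[symmetric]
  proof (intro ball_cong refl, clarify)
    fix v u assume "(v, u) \<in> parcs G"
    then show "h v - h u = head_loss (?r (v, u)) (q (v, u)) \<longleftrightarrow>
        q (v, u) = flow_of_head_loss (?r (v, u)) (h (fst (v, u)) - h (snd (v, u)))"
      using head_loss_eq_iff[OF resistance_pos] by (metis fst_conv snd_conv)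
  qed
  moreover have "q (u, v) = - q (v, u)" if flows: "?flows" and vu: "(v, u) \<in> parcs G" for v u
  proof -
    have "q (u, v) = flow_of_head_loss (?r (v, u)) (- (h v - h u))"
      using bspec[OF flows arc_reversed[OF vu]] resistance_sym[OF vu] by simp
    also have "\<dots> = - q (v, u)"
      using bspec[OF flows vu] by (simp only: flow_of_head_loss_minus fst_conv snd_conv)
    finally show ?thesis .
  qed
  moreover have "(\<forall>v\<in>Vc. (\<Sum>u\<in>neighborhood G v. q (v, u)) = - d v) \<longleftrightarrow> ?demands"
    by (intro ball_cong refl) linarith
  ultimately show ?thesis
    unfolding physically_correct_def arcs by blast
qed

lemma head_difference_eq_sum_incidence:
  assumes "e \<in> parcs G"
  shows "override_on hc hr Vr (fst e) - override_on hc hr Vr (snd e)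
       = (\<Sum>v\<in>Vc. hc v * incidence v e) + (\<Sum>v\<in>Vr. hr v * incidence v e)"
proof -
  let ?h = "override_on hc hr Vr"
  obtain v u where e: "e = (v, u)" "v \<in> pverts G" "u \<in> pverts G" "v \<noteq> u"
    using assms in_arcsD1 in_arcsD2 pair_no_loops by (cases e) force
  have "?h (fst e) - ?h (snd e) = (\<Sum>w\<in>Vr \<union> Vc. ?h w * incidence w e)"
    using sum_incidence[of "pverts G" v u ?h] e nodes_split(1) pair_finite_verts by simp
  also have "\<dots> = (\<Sum>w\<in>Vr. ?h w * incidence w e) + (\<Sum>w\<in>Vc. ?h w * incidence w e)"
    using nodes_split pair_finite_verts by (intro sum.union_disjoint) auto
  also have "\<dots> = (\<Sum>w\<in>Vr. hr w * incidence w e) + (\<Sum>w\<in>Vc. hc w * incidence w e)"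
    using nodes_split(2) by (intro arg_cong2[of _ _ _ _ "(+)"] sum.cong) (auto simp: override_on_def)
  finally show ?thesis by simp
qed

end

theorem theorem3p25:
  fixes G :: "'v pair_pre_digraph"
    and Vr Vc :: "'v set"
    and l \<rho> \<eta> :: "'v \<times> 'v \<Rightarrow> real"
    and Ei Ed :: "('v \<times> 'v) set"
    and hr :: "'v \<Rightarrow> real"
    and qi :: "'v \<times> 'v \<Rightarrow> real"
  assumes "water_distribution_system G Vr Vc l \<rho> \<eta>"
    and "Ei \<subseteq> parcs G" and "card Ei = card Vc"
    and "independent_columns Vc Ei incidence"
    and "Ed = parcs G - Ei"
  shows "\<exists>!(hc, qd, d).
           hc \<in> Vc \<rightarrow>\<^sub>E UNIV \<and> qd \<in> Ed \<rightarrow>\<^sub>E UNIV \<and> d \<in> Vc \<rightarrow>\<^sub>E UNIV \<and>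
           physically_correct G Vc (resistance l \<rho> \<eta>)
             (override_on hc hr Vr) (override_on qd qi Ei) d"
proof -
  interpret water_distribution_system G Vr Vc l \<rho> \<eta> by fact
  let ?r = "resistance l \<rho> \<eta>"
  have "finite Vc" "finite Ei"
    using pair_finite_verts nodes_split(1) assms(2) finite_subset[OF _ pair_finite_arcs] by auto
  define g where "g e = head_loss (?r e) (qi e) - (\<Sum>v\<in>Vr. hr v * incidence v e)" for e
  define flow where "flow hc e =
    flow_of_head_loss (?r e) (override_on hc hr Vr (fst e) - override_on hc hr Vr (snd e))" for hc e
  define demand where "demand q v = - (\<Sum>u\<in>neighborhood G v. q (v, u))" for q :: "'v \<times> 'v \<Rightarrow> real" and v
  have prescribed: "qi e = flow hc e \<longleftrightarrow> (\<Sum>v\<in>Vc. hc v * incidence v e) = g e" if "e \<in> Ei" for hc e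
  proof -
    have e: "e \<in> parcs G" using that assms(2) by blast
    show ?thesis
      unfolding flow_def head_loss_eq_iff[OF resistance_pos[OF e], symmetric]
        head_difference_eq_sum_incidence[OF e] g_def
      by auto
  qed
  obtain hc0 where hc0: "hc0 \<in> Vc \<rightarrow>\<^sub>E UNIV" "\<forall>e\<in>Ei. (\<Sum>v\<in>Vc. hc0 v * incidence v e) = g e"
    and hc0_unique: "\<And>hc. hc \<in> Vc \<rightarrow>\<^sub>E UNIV \<Longrightarrow>
      \<forall>e\<in>Ei. (\<Sum>v\<in>Vc. hc v * incidence v e) = g e \<Longrightarrow> hc = hc0"
    using independent_columns_transposed_unique_solution
      [OF \<open>finite Ei\<close> \<open>finite Vc\<close> assms(4,3), of g] by (elim ex1E) blast
  define qd0 where "qd0 = restrict (flow hc0) Ed"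
  define d0 where "d0 = restrict (demand (override_on qd0 qi Ei)) Vc"
  have "hc \<in> Vc \<rightarrow>\<^sub>E UNIV \<and> qd \<in> Ed \<rightarrow>\<^sub>E UNIV \<and> d \<in> Vc \<rightarrow>\<^sub>E UNIV \<and>
      physically_correct G Vc ?r (override_on hc hr Vr) (override_on qd qi Ei) d \<longleftrightarrow>
      hc = hc0 \<and> qd = qd0 \<and> d = d0" (is "?carriers \<and> _ \<and> _ \<and> ?physical \<longleftrightarrow> _") for hc qd d
  proof -
    have "(\<forall>e\<in>parcs G. override_on qd qi Ei e = flow hc e) \<longleftrightarrow>
        (\<forall>e\<in>Ei. qi e = flow hc e) \<and> (\<forall>e\<in>Ed. qd e = flow hc e)"
      using assms(2,5) by (auto simp: override_on_def)
    then have "physically_correct G Vc ?r (override_on hc hr Vr) (override_on qd qi Ei) d \<longleftrightarrow>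
        (\<forall>e\<in>Ei. (\<Sum>v\<in>Vc. hc v * incidence v e) = g e) \<and> (\<forall>e\<in>Ed. qd e = flow hc e) \<and>
        (\<forall>v\<in>Vc. d v = demand (override_on qd qi Ei) v)"
      unfolding physically_correct_iff_flow_of_head_difference flow_def[symmetric]
        demand_def[symmetric]
      using prescribed by auto
    then have "?carriers \<and> qd \<in> Ed \<rightarrow>\<^sub>E UNIV \<and> d \<in> Vc \<rightarrow>\<^sub>E UNIV \<and> ?physical \<longleftrightarrow>
        (hc \<in> Vc \<rightarrow>\<^sub>E UNIV \<and> (\<forall>e\<in>Ei. (\<Sum>v\<in>Vc. hc v * incidence v e) = g e)) \<and>
        (qd \<in> Ed \<rightarrow>\<^sub>E UNIV \<and> (\<forall>e\<in>Ed. qd e = flow hc e)) \<and>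
        (d \<in> Vc \<rightarrow>\<^sub>E UNIV \<and> (\<forall>v\<in>Vc. d v = demand (override_on qd qi Ei) v))"
      by argo
    also have "\<dots> \<longleftrightarrow> hc = hc0 \<and> qd = restrict (flow hc) Ed \<and>
        d = restrict (demand (override_on qd qi Ei)) Vc"
      unfolding extensional_values_iff using hc0 hc0_unique by blast
    also have "\<dots> \<longleftrightarrow> hc = hc0 \<and> qd = qd0 \<and> d = d0"
      unfolding qd0_def d0_def by blast
    finally show ?thesis .
  qed
  then show ?thesis by auto
qed

end
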